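(* For $\ell\in\mathbb{N}$ and $k\in\mathbb{R}_+$ with $k\le\ell$, the generalized Wu function $\varphi_{\ell,k}$ satisfies, for $0\le r\le2$, $$\varphi_{\ell,k}(r)=\frac{2^{2\ell-k+1}\Gamma(\ell+1)}{\Gamma(\ell-k+1)}\Big(1-\frac{r^2}{4}\Big)^{\ell-k}\left[\frac{1^{(\ell)}}{(3/2)^{(\ell)}}-\sum_{n=0}^{\ell}\frac{(-\ell)^{(n)}(1/2)^{(n)}}{(3/2)^{(n)}}\frac1{n!}\,{}_2F_1\!\left(-n-\tfrac12,1;\ell-k+1;1-\tfrac{r^2}{4}\right)\right].$$
   Context: $\mathbb{R}_+=[0,\infty)$. $f_\ell(r)=(1-r^2)_+^\ell$, $f_\ell*f_\ell(r)=\int_{\mathbb{R}}f_\ell(|y|)f_\ell(|r-y|)dy$ for $r\ge0$. The $f$-form is $\mathcal{F}\varphi(r)=\varphi(\sqrt{2r})$, with inverse $\mathcal{F}^{-1}\varphi(r)=\varphi(r^2/2)$. For $\nu>0$, $I_\nu\varphi(r)=\int_r^\infty\frac{(x-r)^{\nu-1}}{\Gamma(\nu)}\varphi(x)dx$; $I_0=\mathrm{id}$; $I_{-n}=(-1)^n d^n/dr^n$ ($n\in\mathbb{N}$); $I_{-\nu}=I_{n-\nu}I_{-n}$ with $n=\lceil\nu\rceil$. The generalized Wu function is $\varphi_{\ell,k}:=\mathcal{F}^{-1}I_{-k}\mathcal{F}(f_\ell*f_\ell)$ for real $0\le k\le\ell$ (for integer $k$ this equals $\mathscr{D}^k(f_\ell*f_\ell)$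 with $\mathscr{D}\varphi(r)=-\frac1r\varphi'(r)$). Pochhammer symbol: $a^{(0)}=1$, $a^{(n)}=a(a+1)\cdots(a+n-1)$; ${}_2F_1(a,b;c;z)=\sum_{n\ge0}\frac{a^{(n)}b^{(n)}}{c^{(n)}}\frac{z^n}{n!}$. *)

theory Defs
  imports "HOL-Analysis.Analysis"
begin

text \<open>Truncated power function f_l(r) = (1 - r^2)_+^l, with the usual convention
  that (x)_+^0 is the indicator of x > 0.\<close>
definition trunc_pow :: "nat \<Rightarrow> real \<Rightarrow> real" where
  "trunc_pow l r = (if r\<^sup>2 < 1 then (1 - r\<^sup>2) ^ l else 0)"

definition self_conv :: "nat \<Rightarrow> real \<Rightarrow> real" where
  "self_conv l r = (LBINT y. trunc_pow l \<bar>y\<bar> * trunc_pow l \<bar>r - y\<bar>)"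

definition fform :: "(real \<Rightarrow> real) \<Rightarrow> real \<Rightarrow> real" where
  "fform \<phi> r = \<phi> (sqrt (2 * r))"

definition fform_inv :: "(real \<Rightarrow> real) \<Rightarrow> real \<Rightarrow> real" where
  "fform_inv \<phi> r = \<phi> (r\<^sup>2 / 2)"

definition rderiv :: "(real \<Rightarrow> real) \<Rightarrow> real \<Rightarrow> real" where
  "rderiv \<phi> x = (SOME D. (\<phi> has_real_derivative D) (at x within {0..}))"

definition frac_int :: "real \<Rightarrow> (real \<Rightarrow> real) \<Rightarrow> real \<Rightarrow> real" where
  "frac_int \<nu> \<phi> r = (if \<nu> = 0 then \<phi> r
     else (LBINT x:{r..}. ((x - r) powr (\<nu> - 1) / Gamma \<nu>) * \<phi> x))"

definition int_deriv :: "nat \<Rightarrow> (real \<Rightarrow> real) \<Rightarrow> real \<Rightarrow> real" where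
  "int_deriv n \<phi> r = (-1) ^ n * (rderiv ^^ n) \<phi> r"

definition frac_diff :: "real \<Rightarrow> (real \<Rightarrow> real) \<Rightarrow> real \<Rightarrow> real" where
  "frac_diff \<nu> \<phi> = frac_int (of_int \<lceil>\<nu>\<rceil> - \<nu>) (int_deriv (nat \<lceil>\<nu>\<rceil>) \<phi>)"

definition wu_gen :: "nat \<Rightarrow> real \<Rightarrow> real \<Rightarrow> real" where
  "wu_gen l k = fform_inv (frac_diff k (fform (self_conv l)))"

definition hyp2f1 :: "real \<Rightarrow> real \<Rightarrow> real \<Rightarrow> real \<Rightarrow> real" where
  "hyp2f1 a b c z = (\<Sum>n. pochhammer a n * pochhammer b n / pochhammer c n * z ^ n / fact n)"

definition rpow :: "real \<Rightarrow> real \<Rightarrow> real" where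
  "rpow x a = (if a = 0 then 1 else x powr a)"

end

theory Submission
  imports Defs
begin

text \<open>
  Put \<open>p = r / 2\<close>. Centring the convolution integral gives
  \<open>(f\<^sub>l * f\<^sub>l)(r) = \<integral> (((1 - p)\<^sup>2 - v\<^sup>2) ((1 + p)\<^sup>2 - v\<^sup>2))\<^sup>l dv\<close> over \<open>\<bar>v\<bar> \<le> 1 - p\<close>. This equals
  \<open>2\<cdot>4\<^sup>l \<integral> ((u\<^sup>2 - p\<^sup>2) (1 - u\<^sup>2))\<^sup>l du\<close> over \<open>p \<le> u \<le> 1\<close>, because both integrals satisfy the same
  three-term recurrence in \<open>l\<close>. With \<open>t = r\<^sup>2 / 2 = 2p\<^sup>2\<close>, integration by parts turns the latter into
  a multiple of the \<open>l\<close>-fold integral from \<open>t\<close> to \<open>2\<close> of \<open>G(t) = \<integral> (1 - u\<^sup>2)\<^sup>l du\<close> over \<open>sqrt (t / 2) \<le> u \<le> 1\<close>.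
  Hence the generalized Wu function of order \<open>k\<close> is the Riemann--Liouville integral of order \<open>l - k\<close> of \<open>G\<close>.
  Finally, \<open>G\<close> is a combination of the powers \<open>(t / 2)\<close> to the \<open>n + 1/2\<close>, whose binomial series at \<open>t = 2\<close>
  converge absolutely up to \<open>t = 0\<close>; integrating termwise produces the hypergeometric series.
\<close>

section \<open>Power series under fractional integration\<close>

text \<open>The terms \<open>b j\<close> satisfy \<open>(j + 1) * b (j + 1) = (j - a) * b j\<close>.
  Once \<open>j \<ge> a\<close> this makes \<open>a * \<bar>b j\<bar>\<close> a difference of
  consecutive terms of the nonnegative decreasing sequence \<open>j * \<bar>b j\<bar>\<close>, so
  the tail telescopes.\<close>

lemma summable_abs_pochhammer_minus:
  fixes a :: real
  assumes "a > 0"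
  shows "summable (\<lambda>j. \<bar>pochhammer (-a) j / fact j\<bar>)"
proof -
  define b where "b j = pochhammer (-a) j / fact j" for j
  define N where "N = nat \<lceil>a\<rceil>"
  have rec: "real (Suc j) * b (Suc j) = (real j - a) * b j" for j
    by (simp add: b_def pochhammer_Suc divide_simps del: of_nat_Suc)
  have step: "a * \<bar>b j\<bar> = real j * \<bar>b j\<bar> - real (Suc j) * \<bar>b (Suc j)\<bar>" if "j \<ge> N" for j
  proof -
    have "real j \<ge> a" using that by (simp add: N_def nat_le_iff ceiling_le_iff)
    have "real (Suc j) * \<bar>b (Suc j)\<bar> = \<bar>real (Suc j) * b (Suc j)\<bar>" by (simp add: abs_mult)
    also have "\<dots> = (real j - a) * \<bar>b j\<bar>"
      using \<open>real j \<ge> a\<close> by (simp only: rec abs_mult)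
    finally show ?thesis by (simp add: algebra_simps)
  qed
  define u where "u i = real (i + N) * \<bar>b (i + N)\<bar>" for i
  have u_step: "a * \<bar>b (i + N)\<bar> = u i - u (Suc i)" for i
    using step[of "i + N"] by (simp add: u_def)
  have "u (Suc i) \<le> u i" for i
    using u_step[of i] assms by (smt (verit) mult_nonneg_nonneg abs_ge_zero)
  then have "decseq u" by (rule decseq_SucI)
  moreover have "\<And>i. 0 \<le> u i" by (simp add: u_def)
  ultimately obtain L where "u \<longlonglongrightarrow> L"
    using decseq_convergent by blast
  then have "summable (\<lambda>i. u i - u (Suc i))" by (rule telescope_summable')
  then have "summable (\<lambda>i. inverse a * (a * \<bar>b (i + N)\<bar>))"
    unfolding u_step by (rule summable_mult)
  then have "summable (\<lambda>i. \<bar>b (i + N)\<bar>)" using assms by simp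
  then show ?thesis unfolding b_def by (subst (asm) summable_iff_shift)
qed

text \<open>Absolute convergence at the endpoint \<open>R\<close> itself feeds the Weierstrass
  M-test, so continuity reaches the boundary of the disc of convergence.\<close>

lemma continuous_on_powser_Icc:
  fixes e :: "nat \<Rightarrow> real"
  assumes "summable (\<lambda>j. \<bar>e j\<bar> * R ^ j)" "R \<ge> 0"
  shows "continuous_on {0..R} (\<lambda>x. \<Sum>j. e j * x ^ j)"
proof -
  have "uniform_limit {0..R} (\<lambda>n x. \<Sum>j<n. e j * x ^ j) (\<lambda>x. \<Sum>j. e j * x ^ j) sequentially"
    by (rule Weierstrass_m_test[OF _ assms(1)])
       (auto simp: abs_mult intro!: mult_left_mono power_mono)
  then show ?thesis
    by (rule uniform_limit_theorem[rotated]) (auto intro!: always_eventually continuous_intros)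
qed

text \<open>For \<open>z < 1\<close> this is the generalized binomial theorem. Both sides are
  continuous from the left at \<open>1\<close>, the series by its absolute convergence there, which
  settles \<open>z = 1\<close>.\<close>

lemma binomial_series_closed:
  fixes a z :: real
  assumes "a > 0" "0 \<le> z" "z \<le> 1"
  shows "(\<Sum>j. pochhammer (-a) j / fact j * z ^ j) = (1 - z) powr a"
proof -
  let ?f = "\<lambda>z. (\<Sum>j. pochhammer (-a) j / fact j * z ^ j)"
  have eq: "?f z = (1 - z) powr a" if "0 \<le> z" "z < 1" for z
  proof -
    have "(\<lambda>n. (a gchoose n) * (-z) ^ n) sums (1 + (-z)) powr a"
      by (rule gen_binomial_real) (use that in auto)
    moreover have "(a gchoose n) * (-z) ^ n = pochhammer (-a) n / fact n * z ^ n" for n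
    proof -
      have "(a gchoose n) * (-z) ^ n = ((-1) * (-1)) ^ n * (pochhammer (-a) n / fact n * z ^ n)"
        unfolding gbinomial_pochhammer power_minus[of z n] power_mult_distrib by (simp only: mult_ac times_divide_eq_right times_divide_eq_left)
      then show ?thesis by simp
    qed
    ultimately show ?thesis by (simp add: sums_iff)
  qed
  show ?thesis
  proof (cases "z = 1")
    case False
    then show ?thesis using eq assms by simp
  next
    case True
    have "continuous_on {0..1} ?f"
      by (rule continuous_on_powser_Icc) (use summable_abs_pochhammer_minus[OF assms(1)] in auto)
    then have "(?f \<longlongrightarrow> ?f 1) (at 1 within {0..1})"
      unfolding continuous_on by (rule bspec) simp
    then have "(?f \<longlongrightarrow> ?f 1) (at_left 1)"
      by (simp add: at_within_Icc_at_left)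
    then have "((\<lambda>z. (1 - z) powr a) \<longlongrightarrow> ?f 1) (at_left 1)"
    proof (rule Lim_transform_eventually)
      show "eventually (\<lambda>z. ?f z = (1 - z) powr a) (at_left 1)"
        unfolding eventually_at_left_field by (intro exI[of _ 0] conjI allI impI eq) auto
    qed
    moreover have "((\<lambda>z. (1 - z) powr a) \<longlongrightarrow> (1 - 1) powr a) (at_left (1::real))"
      using assms(1) by (intro tendsto_powr' tendsto_diff tendsto_const tendsto_ident_at)
        (auto simp: eventually_at_left_field intro!: exI[of _ 0])
    ultimately have "?f 1 = (1 - 1) powr a"
      by (rule tendsto_unique[OF trivial_limit_at_left_real])
    then show ?thesis using True by simp
  qed
qed

text \<open>The Beta integral B(\<nu>, i+1), scaled to \<open>{t..b}\<close>. Integration by parts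
  lowers \<open>i\<close> by one and raises \<nu> by one, so \<nu> has to vary in the
  induction.\<close>

lemma has_integral_Beta_power:
  fixes t b \<nu> :: real
  assumes "\<nu> > 0" "t \<le> b"
  shows "((\<lambda>x. (x - t) powr (\<nu> - 1) * (b - x) ^ i) has_integral
           (b - t) powr \<nu> * (b - t) ^ i * fact i / pochhammer \<nu> (Suc i)) {t..b}"
  using assms(1)
proof (induction i arbitrary: \<nu>)
  have cont: "continuous_on {t..b} (\<lambda>x. (x - t) powr \<nu>)" if "\<nu> > 0" for \<nu>
    by (intro continuous_on_powr' continuous_on_diff continuous_on_id continuous_on_const) (use that in auto)
  {
    case 0
    have "((\<lambda>x. (x - t) powr (\<nu> - 1)) has_integral (b - t) powr \<nu> / \<nu> - (t - t) powr \<nu> / \<nu>) {t..b}"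
    \<comment> \<open>For \<nu> < 1 the integrand is unbounded at \<open>t\<close>; the interior
      version asks for the derivative on the open interval only.\<close>
    proof (rule fundamental_theorem_of_calculus_interior[where f = "\<lambda>x. (x - t) powr \<nu> / \<nu>"])
      show "continuous_on {t..b} (\<lambda>x. (x - t) powr \<nu> / \<nu>)"
        using 0 by (intro continuous_on_divide cont) auto
    qed (use 0 assms(2) in \<open>auto intro!: derivative_eq_intros
             simp flip: has_real_derivative_iff_has_vector_derivative\<close>)
    then show ?case using 0 by simp
  next
    case (Suc i)
    let ?A = "\<lambda>x. (x - t) powr (\<nu> - 1) * (b - x) ^ Suc i"
    let ?B = "\<lambda>x. (x - t) powr (\<nu> + 1 - 1) * (b - x) ^ i"
    have "((\<lambda>x. \<nu> * ?A x - (real i + 1) * ?B x)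
        has_integral (b - t) powr \<nu> * (b - b) ^ Suc i - (t - t) powr \<nu> * (b - t) ^ Suc i) {t..b}"
    proof (rule fundamental_theorem_of_calculus_interior[where f = "\<lambda>x. (x - t) powr \<nu> * (b - x) ^ Suc i"])
      show "continuous_on {t..b} (\<lambda>x. (x - t) powr \<nu> * (b - x) ^ Suc i)"
        using Suc.prems by (intro continuous_intros cont) auto
    next
      fix x assume x: "x \<in> {t<..<b}"
      have "((\<lambda>x. (x - t) powr \<nu>) has_real_derivative \<nu> * (x - t) powr (\<nu> - 1)) (at x)"
        using x by (auto intro!: derivative_eq_intros)
      moreover have "((\<lambda>x. (b - x) ^ Suc i) has_real_derivative - (real i + 1) * (b - x) ^ i) (at x)"
        by (rule derivative_eq_intros refl | simp add: algebra_simps)+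
      ultimately have "((\<lambda>x. (x - t) powr \<nu> * (b - x) ^ Suc i) has_real_derivative
          \<nu> * (x - t) powr (\<nu> - 1) * (b - x) ^ Suc i + - (real i + 1) * (b - x) ^ i * (x - t) powr \<nu>) (at x)"
        by (rule DERIV_mult)
      then show "((\<lambda>x. (x - t) powr \<nu> * (b - x) ^ Suc i) has_vector_derivative \<nu> * ?A x - (real i + 1) * ?B x) (at x)"
        by (simp add: has_real_derivative_iff_has_vector_derivative algebra_simps)
    qed (rule assms(2))
    moreover have "((\<lambda>x. (real i + 1) * ?B x) has_integral
        (real i + 1) * ((b - t) powr (\<nu> + 1) * (b - t) ^ i * fact i / pochhammer (\<nu> + 1) (Suc i))) {t..b}"
      using Suc.IH[of "\<nu> + 1"] Suc.prems by (intro has_integral_mult_right) auto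
    ultimately have "((\<lambda>x. (\<nu> * ?A x - (real i + 1) * ?B x) + (real i + 1) * ?B x) has_integral
       0 + (real i + 1) * ((b - t) powr (\<nu> + 1) * (b - t) ^ i * fact i / pochhammer (\<nu> + 1) (Suc i))) {t..b}"
      by (intro has_integral_add) auto
    then have "((\<lambda>x. inverse \<nu> * (\<nu> * ?A x)) has_integral
       inverse \<nu> * ((real i + 1) * ((b - t) powr (\<nu> + 1) * (b - t) ^ i * fact i / pochhammer (\<nu> + 1) (Suc i)))) {t..b}"
      by (intro has_integral_mult_right) simp
    moreover have "(b - t) powr (\<nu> + 1) = (b - t) powr \<nu> * (b - t)"
      using assms(2) by (simp add: powr_add)
    moreover have "(\<lambda>x. inverse \<nu> * (\<nu> * ?A x)) = ?A"
      using Suc.prems by (simp add: fun_eq_iff)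
    ultimately show ?case
      by (simp only: pochhammer_rec[of \<nu> "Suc i"] divide_inverse inverse_mult_distrib fact_Suc) (simp add: mult_ac add_ac)
  }
qed

text \<open>The integrand is nonnegative and measurable, so its gauge integral is also its Lebesgue
  integral.\<close>

lemma has_bochner_integral_Beta_power:
  fixes t b \<nu> :: real
  assumes "\<nu> > 0" "t \<le> b"
  shows "has_bochner_integral lborel (\<lambda>x. indicator {t..b} x * ((x - t) powr (\<nu> - 1) * (b - x) ^ i))
           ((b - t) powr \<nu> * (b - t) ^ i * fact i / pochhammer \<nu> (Suc i))"
    (is "has_bochner_integral _ ?f ?I")
proof (rule has_bochner_integral_nn_integral)
  show m: "?f \<in> borel_measurable lborel" by measurable
  have "(?f has_integral ?I) UNIV"
  proof -
    have "?f = (\<lambda>x. if x \<in> {t..b} then (x - t) powr (\<nu> - 1) * (b - x) ^ i else 0)"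
      by (auto simp: indicator_def)
    then show ?thesis
      using has_integral_Beta_power[OF assms] by (simp only: has_integral_restrict_UNIV)
  qed
  then show "(\<integral>\<^sup>+ x. ennreal (?f x) \<partial>lborel) = ennreal ?I"
    using m by (intro nn_integral_has_integral_lborel) (auto simp: indicator_def)
  show "0 \<le> ?I" using assms by (auto intro!: mult_nonneg_nonneg divide_nonneg_nonneg pochhammer_nonneg)
  show "AE x in lborel. 0 \<le> ?f x" by (auto simp: indicator_def)
qed

text \<open>Sum and integral may be exchanged because the integrals of the absolute values are
  summable. The extra factor \<open>(b - x) ^ m\<close> accommodates series that already arise from
  \<open>m\<close> integrations.\<close>

lemma sums_lborel_integral_frac_powser:
  fixes e :: "nat \<Rightarrow> real"
  assumes "\<nu> > 0" "0 \<le> t" "t \<le> b" and summ: "summable (\<lambda>j. \<bar>e j\<bar> * b ^ j)"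
  shows "(\<lambda>j. e j * ((b - t) powr \<nu> * (b - t) ^ (j + m) * fact (j + m) / pochhammer \<nu> (Suc (j + m)))) sums
    (\<integral>x. indicator {t..b} x * ((x - t) powr (\<nu> - 1) * (\<Sum>j. e j * (b - x) ^ (j + m))) \<partial>lborel)"
proof -
  let ?g = "\<lambda>j x. indicator {t..b} x * ((x - t) powr (\<nu> - 1) * (b - x) ^ (j + m))"
  let ?I = "\<lambda>j. (b - t) powr \<nu> * (b - t) ^ (j + m) * fact (j + m) / pochhammer \<nu> (Suc (j + m))"
  have b: "b \<ge> 0" using assms by simp
  note B = has_bochner_integral_Beta_power[OF assms(1,3)]
  have i: "integrable lborel (\<lambda>x. e j * ?g j x)" for j
    using B[of "j + m"] by (intro integrable_mult_right) (auto simp: has_bochner_integral_iff)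
  have g0: "?g j x \<ge> 0" for j x by (auto simp: indicator_def)
  have summx: "summable (\<lambda>j. norm (e j * (b - x) ^ (j + m)))" if "x \<in> {t..b}" for x
  proof (rule summable_comparison_test')
    show "summable (\<lambda>j. b ^ m * (\<bar>e j\<bar> * b ^ j))" using summ by (rule summable_mult)
    fix j assume "j \<ge> (0::nat)"
    have "(b - x) ^ (j + m) \<le> b ^ (j + m)" using that assms by (intro power_mono) auto
    then have "\<bar>e j\<bar> * (b - x) ^ (j + m) \<le> \<bar>e j\<bar> * b ^ (j + m)" by (intro mult_left_mono) auto
    then show "norm (norm (e j * (b - x) ^ (j + m))) \<le> b ^ m * (\<bar>e j\<bar> * b ^ j)"
      using that by (simp add: abs_mult power_add mult_ac)
  qed
  have summ2: "summable (\<lambda>j. norm (e j * ?g j x))" for x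
  proof (cases "x \<in> {t..b}")
    case True
    then have "summable (\<lambda>j. (x - t) powr (\<nu> - 1) * norm (e j * (b - x) ^ (j + m)))"
      by (intro summable_mult summx)
    then show ?thesis using True by (simp add: abs_mult mult_ac)
  qed simp
  have nI: "(\<integral>x. norm (e j * ?g j x) \<partial>lborel) = \<bar>e j\<bar> * ?I j" for j
  proof -
    have "(\<lambda>x. norm (e j * ?g j x)) = (\<lambda>x. \<bar>e j\<bar> * ?g j x)"
      unfolding real_norm_def abs_mult[of "e j"] using g0 by (simp only: abs_of_nonneg)
    then show ?thesis using B[of "j + m"] by (simp only: has_bochner_integral_iff integral_mult_right_zero)
  qed
  \<comment> \<open>After the leading factor \<nu> is split off, each remaining factor of the
    Pochhammer symbol dominates the corresponding factor of the factorial.\<close>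
  have le: "fact (j + m) / pochhammer \<nu> (Suc (j + m)) \<le> 1 / \<nu>" for j
  proof -
    have "pochhammer (\<nu> + 1) i \<ge> fact i" for i
      using pochhammer_fact[of i, where ?'a = real] assms(1)
      by (simp add: pochhammer_prod prod_mono)
    then have "fact (j+m) * (1/\<nu>) \<le> pochhammer (\<nu> + 1) (j+m) * (1/\<nu>)"
      using assms(1) by (intro mult_right_mono) auto
    moreover have "pochhammer (\<nu> + 1) (j+m) > 0" using assms by (intro pochhammer_pos) auto
    ultimately show ?thesis
      using assms(1) by (simp add: pochhammer_rec field_simps)
  qed
  have sI: "summable (\<lambda>j. \<integral>x. norm (e j * ?g j x) \<partial>lborel)"
    unfolding nI
  proof (rule summable_comparison_test')
    show "summable (\<lambda>j. ((b - t) powr \<nu> * (1 / \<nu>)) * norm (e j * (b - t) ^ (j + m)))"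
      using assms by (intro summable_mult summx) auto
    fix j assume "j \<ge> (0::nat)"
    have p: "pochhammer \<nu> (Suc (j + m)) > 0" using assms by (intro pochhammer_pos) auto
    have "(b - t) powr \<nu> * (\<bar>e j\<bar> * (b - t) ^ (j + m)) * (fact (j + m) / pochhammer \<nu> (Suc (j + m)))
       \<le> (b - t) powr \<nu> * (\<bar>e j\<bar> * (b - t) ^ (j + m)) * (1 / \<nu>)"
      using assms by (intro mult_left_mono le) auto
    then show "norm (\<bar>e j\<bar> * ?I j) \<le> (b - t) powr \<nu> * (1 / \<nu>) * norm (e j * (b - t) ^ (j + m))"
      using assms p by (simp add: abs_mult mult_ac)
  qed
  have "(\<lambda>j. \<integral>x. e j * ?g j x \<partial>lborel) sums (\<integral>x. (\<Sum>j. e j * ?g j x) \<partial>lborel)"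
    by (rule sums_integral[OF i _ sI]) (use summ2 in auto)
  also have "(\<lambda>j. \<integral>x. e j * ?g j x \<partial>lborel) = (\<lambda>j. e j * ?I j)"
    using B by (intro ext) (simp only: has_bochner_integral_iff integral_mult_right_zero)
  also have "(\<lambda>x. \<Sum>j. e j * ?g j x) = (\<lambda>x. indicator {t..b} x * ((x - t) powr (\<nu> - 1) * (\<Sum>j. e j * (b - x) ^ (j + m))))"
  proof
    fix x
    show "(\<Sum>j. e j * ?g j x) = indicator {t..b} x * ((x - t) powr (\<nu> - 1) * (\<Sum>j. e j * (b - x) ^ (j + m)))"
    proof (cases "x \<in> {t..b}")
      case True
      have "(\<Sum>j. (x - t) powr (\<nu> - 1) * (e j * (b - x) ^ (j + m))) = (x - t) powr (\<nu> - 1) * (\<Sum>j. e j * (b - x) ^ (j + m))"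
        by (rule suminf_mult) (rule summable_norm_cancel[OF summx[OF True]])
      then show ?thesis using True by (simp add: mult_ac)
    qed simp
  qed
  finally show ?thesis .
qed

section \<open>Powers of even quartics\<close>

definition quartic :: "real \<Rightarrow> real \<Rightarrow> real \<Rightarrow> real \<Rightarrow> real" where
  "quartic \<alpha> \<beta> \<gamma> x = \<alpha> * x ^ 4 + \<beta> * x\<^sup>2 + \<gamma>"

lemma continuous_on_quartic [continuous_intros]:
  "continuous_on S f \<Longrightarrow> continuous_on S (\<lambda>x. quartic \<alpha> \<beta> \<gamma> (f x))"
  unfolding quartic_def by (intro continuous_intros)

text \<open>With Q the quartic, consider the moments \<open>I j n\<close> of
  \<open>x ^ j * Q x ^ n\<close>. Expanding one factor Q relates level \<open>n + 1\<close> to level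
  \<open>n\<close>; integrating the derivative of \<open>x ^ Suc j * Q x ^ Suc n\<close>, whose
  boundary terms vanish, relates moments of one level. Eliminating the moments with
  \<open>j = 2, 4, 6\<close> leaves the recurrence.\<close>

lemma integral_quartic_power_rec:
  assumes "c \<le> d" "quartic \<alpha> \<beta> \<gamma> c = 0" "quartic \<alpha> \<beta> \<gamma> d = 0"
  defines "M \<equiv> \<lambda>l. integral {c..d} (\<lambda>x. quartic \<alpha> \<beta> \<gamma> x ^ l)"
  shows "\<alpha> * (4 * real l + 9) * (4 * real l + 7) * M (Suc (Suc l)) =
    (2 * real l + 4) * (2 * real l + 3) * (8 * \<alpha> * \<gamma> - \<beta>\<^sup>2) * M (Suc l)
    + (2 * real l + 4) * (2 * real l + 2) * \<gamma> * (\<beta>\<^sup>2 - 4 * \<alpha> * \<gamma>) * M l"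
proof -
  let ?Q = "quartic \<alpha> \<beta> \<gamma>"
  define I where "I j l = integral {c..d} (\<lambda>x. x ^ j * ?Q x ^ l)" for j l :: nat
  have int: "(\<lambda>x. x ^ j * ?Q x ^ l) integrable_on {c..d}" for j l
    by (intro integrable_continuous_interval continuous_intros)
  have lin: "integral {c..d} (\<lambda>x. u * (x ^ i * ?Q x ^ n) + v * (x ^ j * ?Q x ^ n) + w * (x ^ k * ?Q x ^ n))
      = u * I i n + v * I j n + w * I k n" for u v w i j k n
    using has_integral_add[OF has_integral_add[OF has_integral_mult_right[OF integrable_integral[OF int[of i n]], of u]
       has_integral_mult_right[OF integrable_integral[OF int[of j n]], of v]]
       has_integral_mult_right[OF integrable_integral[OF int[of k n]], of w]]
    unfolding I_def by (rule integral_unique)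
  have expand: "I j (Suc n) = \<alpha> * I (j + 4) n + \<beta> * I (j + 2) n + \<gamma> * I j n" for j n
    unfolding lin[symmetric] unfolding I_def
    by (simp add: quartic_def algebra_simps power_add power2_eq_square)
  have parts: "\<alpha> * (real j + 4 * real n + 5) * I (j + 4) n + \<beta> * (real j + 2 * real n + 3) * I (j + 2) n
      + \<gamma> * (real j + 1) * I j n = 0" for j n
  proof -
    have "((\<lambda>x. \<alpha> * (real j + 4 * real n + 5) * (x ^ (j + 4) * ?Q x ^ n) + \<beta> * (real j + 2 * real n + 3) * (x ^ (j + 2) * ?Q x ^ n)
      + \<gamma> * (real j + 1) * (x ^ j * ?Q x ^ n)) has_integral d ^ Suc j * ?Q d ^ Suc n - c ^ Suc j * ?Q c ^ Suc n) {c..d}"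
    proof (rule fundamental_theorem_of_calculus[OF assms(1)])
      fix x :: real
      have "(?Q has_real_derivative 4 * \<alpha> * x ^ 3 + 2 * \<beta> * x) (at x)"
        unfolding quartic_def by (auto intro!: derivative_eq_intros)
      from DERIV_mult[OF DERIV_power[OF DERIV_ident, of "Suc j"] DERIV_power[OF this, of "Suc n"]]
      have "((\<lambda>x. x ^ Suc j * ?Q x ^ Suc n) has_real_derivative
         (real (Suc j) * x ^ j) * ?Q x ^ Suc n + real (Suc n) * ((4 * \<alpha> * x ^ 3 + 2 * \<beta> * x) * ?Q x ^ n) * x ^ Suc j) (at x)"
        by (simp add: mult_ac)
      moreover have "(real (Suc j) * x ^ j) * ?Q x ^ Suc n + real (Suc n) * ((4 * \<alpha> * x ^ 3 + 2 * \<beta> * x) * ?Q x ^ n) * x ^ Suc j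
        = \<alpha> * (real j + 4 * real n + 5) * (x ^ (j + 4) * ?Q x ^ n) + \<beta> * (real j + 2 * real n + 3) * (x ^ (j + 2) * ?Q x ^ n)
      + \<gamma> * (real j + 1) * (x ^ j * ?Q x ^ n)"
        unfolding power_Suc[of "?Q x" n]
        by (subst quartic_def, simp add: power_add) (simp add: algebra_simps power2_eq_square power3_eq_cube power4_eq_xxxx)
      ultimately show "((\<lambda>x. x ^ Suc j * ?Q x ^ Suc n) has_vector_derivative
          \<alpha> * (real j + 4 * real n + 5) * (x ^ (j + 4) * ?Q x ^ n) + \<beta> * (real j + 2 * real n + 3) * (x ^ (j + 2) * ?Q x ^ n)
      + \<gamma> * (real j + 1) * (x ^ j * ?Q x ^ n)) (at x within {c..d})"
        by (simp add: has_real_derivative_iff_has_vector_derivative has_vector_derivative_at_within del: power_Suc)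
    qed
    then show ?thesis
      unfolding lin[symmetric] using assms(2,3) by (simp add: integral_unique)
  qed
  have M: "M n = I 0 n" for n by (simp add: M_def I_def)
  define s where "s = real l"
  have e0: "\<alpha> * (4 * s + 5) * I 4 l + \<beta> * (2 * s + 3) * I 2 l + \<gamma> * M l = 0"
    using parts[of 0 l] by (simp add: M s_def flip: numeral_2_eq_2)
  have e1: "M (Suc l) = \<alpha> * I 4 l + \<beta> * I 2 l + \<gamma> * M l"
    using expand[of 0 l] by (simp add: M flip: numeral_2_eq_2)
  have e2: "I 2 (Suc l) = \<alpha> * I 6 l + \<beta> * I 4 l + \<gamma> * I 2 l"
    using expand[of 2 l] by simp
  have e3: "\<alpha> * (4 * s + 7) * I 6 l + \<beta> * (2 * s + 5) * I 4 l + \<gamma> * 3 * I 2 l = 0"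
    using parts[of 2 l] by (simp add: s_def algebra_simps)
  have e4: "\<alpha> * (4 * s + 9) * I 4 (Suc l) + \<beta> * (2 * s + 5) * I 2 (Suc l) + \<gamma> * M (Suc l) = 0"
    using parts[of 0 "Suc l"] by (simp add: M s_def algebra_simps flip: numeral_2_eq_2)
  have e5: "M (Suc (Suc l)) = \<alpha> * I 4 (Suc l) + \<beta> * I 2 (Suc l) + \<gamma> * M (Suc l)"
    using expand[of 0 "Suc l"] by (simp add: M flip: numeral_2_eq_2)
  \<comment> \<open>\<open>f1\<close>, \<open>f2\<close> and \<open>f3\<close> each eliminate the
    moment multiplied by \<alpha>; \<open>f4\<close> eliminates \<open>I 2 l\<close>
    instead.\<close>
  have f1: "(4 * s + 5) * M (Suc l) = (2 * s + 2) * (\<beta> * I 2 l + 2 * \<gamma> * M l)"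
    using e0 e1 by algebra
  have f2: "(4 * s + 7) * I 2 (Suc l) = (2 * s + 2) * (\<beta> * I 4 l + 2 * \<gamma> * I 2 l)"
    using e2 e3 by algebra
  have f3: "(4 * s + 9) * M (Suc (Suc l)) = (2 * s + 4) * (\<beta> * I 2 (Suc l) + 2 * \<gamma> * M (Suc l))"
    using e4 e5 by algebra
  have f4: "\<alpha> * (2 * s + 2) * I 4 l + (2 * s + 3) * M (Suc l) = (2 * s + 2) * \<gamma> * M l"
    using e0 e1 by algebra
  have f5: "\<alpha> * ((4 * s + 7) * (\<beta> * I 2 (Suc l) + 2 * \<gamma> * M (Suc l)))
     = (2 * s + 3) * (8 * \<alpha> * \<gamma> - \<beta>\<^sup>2) * M (Suc l) + (2 * s + 2) * \<gamma> * (\<beta>\<^sup>2 - 4 * \<alpha> * \<gamma>) * M l"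
    (is "?l = ?r")
  proof -
    \<comment> \<open>The weights on \<open>f2\<close>, \<open>f1\<close> and \<open>f4\<close> are
      chosen so that \<open>I 2 l\<close> and \<open>I 4 l\<close> cancel.\<close>
    have "?l - ?r = \<alpha> * \<beta> * ((4 * s + 7) * I 2 (Suc l) - (2 * s + 2) * (\<beta> * I 4 l + 2 * \<gamma> * I 2 l))
       - 2 * \<alpha> * \<gamma> * ((4 * s + 5) * M (Suc l) - (2 * s + 2) * (\<beta> * I 2 l + 2 * \<gamma> * M l))
       + \<beta>\<^sup>2 * ((\<alpha> * (2 * s + 2) * I 4 l + (2 * s + 3) * M (Suc l)) - (2 * s + 2) * \<gamma> * M l)"
      by (simp add: algebra_simps power2_eq_square)
    then show ?thesis unfolding f1 f2 f4 by simp
  qed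
  have "\<alpha> * (4 * s + 9) * (4 * s + 7) * M (Suc (Suc l))
     = (2 * s + 4) * (\<alpha> * ((4 * s + 7) * (\<beta> * I 2 (Suc l) + 2 * \<gamma> * M (Suc l))))"
    using f3 by algebra
  also have "\<dots> = (2 * s + 4) * ((2 * s + 3) * (8 * \<alpha> * \<gamma> - \<beta>\<^sup>2) * M (Suc l) + (2 * s + 2) * \<gamma> * (\<beta>\<^sup>2 - 4 * \<alpha> * \<gamma>) * M l)"
    unfolding f5 ..
  finally show ?thesis
    unfolding s_def by (simp add: algebra_simps)
qed

text \<open>The first power, needed to start the two-step recurrence.\<close>

lemma integral_quartic:
  assumes "c \<le> d"
  shows "integral {c..d} (quartic \<alpha> \<beta> \<gamma>) =
    \<alpha> * (d ^ 5 - c ^ 5) / 5 + \<beta> * (d ^ 3 - c ^ 3) / 3 + \<gamma> * (d - c)"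
proof -
  have "(quartic \<alpha> \<beta> \<gamma> has_integral
     (\<alpha> * d ^ 5 / 5 + \<beta> * d ^ 3 / 3 + \<gamma> * d) - (\<alpha> * c ^ 5 / 5 + \<beta> * c ^ 3 / 3 + \<gamma> * c)) {c..d}"
  proof (rule fundamental_theorem_of_calculus[OF assms])
    fix x :: real
    have "((\<lambda>x. \<alpha> * x ^ 5 / 5 + \<beta> * x ^ 3 / 3 + \<gamma> * x) has_real_derivative quartic \<alpha> \<beta> \<gamma> x) (at x within {c..d})"
      unfolding quartic_def by (auto intro!: derivative_eq_intros)
    then show "((\<lambda>x. \<alpha> * x ^ 5 / 5 + \<beta> * x ^ 3 / 3 + \<gamma> * x) has_vector_derivative quartic \<alpha> \<beta> \<gamma> x) (at x within {c..d})"
      by (simp add: has_real_derivative_iff_has_vector_derivative)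
  qed
  then show ?thesis by (simp add: integral_unique algebra_simps diff_divide_distrib)
qed

text \<open>After division by \<open>\<alpha>\<close> the recurrence above involves only \<open>\<gamma>\<close> and \<open>\<beta>\<^sup>2 / \<alpha>\<close>, through the
  combinations \<open>8\<gamma> - \<beta>\<^sup>2 / \<alpha>\<close> and \<open>\<gamma> (\<beta>\<^sup>2 / \<alpha> - 4\<gamma>)\<close>, and these agree for the two quartics below.\<close>
lemma integral_quartic_power_transform:
  fixes p :: real
  assumes "0 \<le> p" "p \<le> 1"
  shows "integral {- (1 - p)..1 - p} (\<lambda>v. quartic 1 (- 2 * (1 + p\<^sup>2)) ((1 - p\<^sup>2)\<^sup>2) v ^ l) =
    2 * integral {p..1} (\<lambda>u. quartic (-4) (4 * (1 + p\<^sup>2)) (- 4 * p\<^sup>2) u ^ l)"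
    (is "integral ?I (\<lambda>v. ?f v ^ l) = 2 * integral ?J (\<lambda>u. ?g u ^ l)")
proof -
  \<comment> \<open>The quartics factor as \<open>((1 - p)\<^sup>2 - v\<^sup>2) * ((1 + p)\<^sup>2 -
    v\<^sup>2)\<close> and \<open>4 * (u\<^sup>2 - p\<^sup>2) * (1 - u\<^sup>2)\<close>.\<close>
  have zf: "?f (- (1 - p)) = 0" "?f (1 - p) = 0" and zg: "?g p = 0" "?g 1 = 0"
    unfolding quartic_def by (algebra, algebra, algebra, simp)
  have le: "- (1 - p) \<le> 1 - p" using assms by simp
  show ?thesis
  proof (induction l rule: induct_nat_012)
    case 0
    then show ?case using assms by simp
  next
    case 1
    show ?case
      unfolding One_nat_def[symmetric] power_one_right integral_quartic[OF le] integral_quartic[OF assms(2)]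
      by (simp add: field_simps power_numeral_reduce)
  next
    case (ge2 l)
    let ?s = "real l"
    have f: "1 * (4 * ?s + 9) * (4 * ?s + 7) * integral ?I (\<lambda>v. ?f v ^ Suc (Suc l)) =
      (2 * ?s + 4) * (2 * ?s + 3) * (8 * 1 * (1 - p\<^sup>2)\<^sup>2 - (- 2 * (1 + p\<^sup>2))\<^sup>2) * (2 * integral ?J (\<lambda>u. ?g u ^ Suc l))
      + (2 * ?s + 4) * (2 * ?s + 2) * (1 - p\<^sup>2)\<^sup>2 * ((- 2 * (1 + p\<^sup>2))\<^sup>2 - 4 * 1 * (1 - p\<^sup>2)\<^sup>2) * (2 * integral ?J (\<lambda>u. ?g u ^ l))"
      using integral_quartic_power_rec[OF le zf, of l] unfolding ge2 .
    note g = integral_quartic_power_rec[OF assms(2) zg, of l]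
    define X Y Z W where "X = integral ?I (\<lambda>v. ?f v ^ Suc (Suc l))" and "Y = integral ?J (\<lambda>u. ?g u ^ Suc (Suc l))"
      and "Z = integral ?J (\<lambda>u. ?g u ^ Suc l)" and "W = integral ?J (\<lambda>u. ?g u ^ l)"
    have "(4 * ?s + 9) * (4 * ?s + 7) * X = (4 * ?s + 9) * (4 * ?s + 7) * (2 * Y)"
      using f g unfolding X_def[symmetric] Y_def[symmetric] Z_def[symmetric] W_def[symmetric] by algebra
    moreover have "(4 * ?s + 9) * (4 * ?s + 7) \<noteq> 0" by (auto simp: add_nonneg_eq_0_iff)
    ultimately have "X = 2 * Y" by (metis mult_left_cancel)
    then show ?case unfolding X_def Y_def .
  qed
qed

section \<open>Expansion of the integral of \<open>(1 - u\<^sup>2)\<^sup>l\<close>\<close>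

text \<open>Up to the factor \<open>2 * n + 1\<close> a signed binomial coefficient: the coefficient
  of \<open>u ^ (2 * n + 1)\<close> in the integral of \<open>(1 - s\<^sup>2) ^ l\<close> over
  \<open>0 \<le> s \<le> u\<close>.\<close>

definition wu_coeff :: "nat \<Rightarrow> nat \<Rightarrow> real" where
  "wu_coeff l n = pochhammer (- real l) n * pochhammer (1/2) n / pochhammer (3/2) n / fact n"

text \<open>The integral of \<open>(1 - u\<^sup>2) ^ l\<close> over the unit interval, as shown
  within \<open>wu_primitive_1\<close>.\<close>

definition wu_const :: "nat \<Rightarrow> real" where
  "wu_const l = pochhammer 1 l / pochhammer (3/2) l"

lemma wu_coeff_eq: "wu_coeff l n * (2 * real n + 1) = (-1) ^ n * real (l choose n)"
proof -
  have p: "pochhammer (3/2::real) n \<noteq> 0"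
    using pochhammer_pos[of "3/2::real" n] by simp
  have "pochhammer (1/2) (Suc n) = (1/2::real) * pochhammer (3/2) n"
    by (simp add: pochhammer_rec)
  then have "pochhammer (1/2) n * (2 * real n + 1) = pochhammer (3/2) n"
    by (simp add: pochhammer_Suc field_simps)
  then have "wu_coeff l n * (2 * real n + 1) = pochhammer (- real l) n / fact n"
    using p by (simp add: wu_coeff_def divide_simps)
  also have "\<dots> = (-1) ^ n * real (l choose n)"
    unfolding binomial_gbinomial gbinomial_pochhammer by simp
  finally show ?thesis .
qed

text \<open>The integral of \<open>(1 - s\<^sup>2) ^ l\<close> over
  \<open>u \<le> s \<le> 1\<close>, the function G of the overview before the substitution
  \<open>u = sqrt (t / 2)\<close>.\<close>

definition wu_primitive :: "nat \<Rightarrow> real \<Rightarrow> real" where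
  "wu_primitive l u = wu_const l - (\<Sum>n\<le>l. wu_coeff l n * u ^ (2 * n + 1))"

lemma wu_primitive_deriv:
  "((\<lambda>u. wu_primitive l u) has_real_derivative - ((1 - u\<^sup>2) ^ l)) (at u within S)"
proof -
  have "(1 - u\<^sup>2) ^ l = (- (u\<^sup>2) + 1) ^ l" by simp
  also have "\<dots> = (\<Sum>n\<le>l. real (l choose n) * (- (u\<^sup>2)) ^ n * 1 ^ (l - n))"
    by (rule binomial_ring)
  also have "\<dots> = (\<Sum>n\<le>l. wu_coeff l n * (2 * real n + 1) * u ^ (2 * n))"
    unfolding wu_coeff_eq by (intro sum.cong refl) (simp add: power_minus[of "u\<^sup>2"] power_mult)
  finally have *: "(1 - u\<^sup>2) ^ l = (\<Sum>n\<le>l. wu_coeff l n * (2 * real n + 1) * u ^ (2 * n))" .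
  have "((\<lambda>u. wu_const l - (\<Sum>n\<le>l. wu_coeff l n * u ^ (2 * n + 1))) has_real_derivative
     0 - (\<Sum>n\<le>l. wu_coeff l n * ((2 * real n + 1) * u ^ (2 * n)))) (at u within S)"
  proof (intro DERIV_diff DERIV_const DERIV_sum DERIV_cmult)
    fix n
    show "((\<lambda>u. u ^ (2 * n + 1)) has_real_derivative (2 * real n + 1) * u ^ (2 * n)) (at u within S)"
      using DERIV_pow[of "2 * n + 1" u S] by (simp add: add_ac)
  qed
  then show ?thesis by (simp only: wu_primitive_def * mult.assoc diff_0)
qed

text \<open>This fixes the constant of integration. The integral \<open>J l\<close> over
  \<open>{0..1}\<close> is the difference of the values at \<open>0\<close> and \<open>1\<close>;
  differentiating \<open>u * (1 - u\<^sup>2) ^ Suc l\<close> yields a recurrence that identifies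
  \<open>J l\<close> with \<open>wu_const l\<close>, the value at \<open>0\<close>.\<close>

lemma wu_primitive_1: "wu_primitive l 1 = 0"
proof -
  define J where "J l = integral {0..1} (\<lambda>u::real. (1 - u\<^sup>2) ^ l)" for l :: nat
  have hi: "((\<lambda>u::real. (1 - u\<^sup>2) ^ l) has_integral J l) {0..1}" for l
    unfolding J_def by (intro integrable_integral integrable_continuous_interval continuous_intros)
  have J: "J l = wu_primitive l 0 - wu_primitive l 1" for l
  proof -
    have "((\<lambda>u. - ((1 - u\<^sup>2) ^ l)) has_integral wu_primitive l 1 - wu_primitive l 0) {0..1}"
      by (intro fundamental_theorem_of_calculus)
         (auto simp flip: has_real_derivative_iff_has_vector_derivative intro: wu_primitive_deriv)
    from has_integral_neg[OF this] have "((\<lambda>u. (1 - u\<^sup>2) ^ l) has_integral wu_primitive l 0 - wu_primitive l 1) {0..1}"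
      by simp
    with hi[of l] show ?thesis by (rule has_integral_unique)
  qed
  have rec: "(2 * real l + 3) * J (Suc l) = (2 * real l + 2) * J l" for l
  proof -
    have "((\<lambda>u::real. (2 * real l + 3) * (1 - u\<^sup>2) ^ Suc l - (2 * real l + 2) * (1 - u\<^sup>2) ^ l)
       has_integral 1 * (1 - 1\<^sup>2) ^ Suc l - 0 * (1 - 0\<^sup>2) ^ Suc l) {0..1}"
    proof (rule fundamental_theorem_of_calculus)
      fix u :: real
      have "((\<lambda>u. 1 - u\<^sup>2) has_real_derivative - 2 * u) (at u within {0..1})"
        by (auto intro!: derivative_eq_intros)
      from DERIV_power[OF this, of "Suc l"]
      have "((\<lambda>u. (1 - u\<^sup>2) ^ Suc l) has_real_derivative real (Suc l) * (- 2 * u * (1 - u\<^sup>2) ^ l)) (at u within {0..1})"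
        by (simp only: diff_Suc_Suc diff_zero)
      from DERIV_mult[OF DERIV_ident this]
      have "((\<lambda>u. u * (1 - u\<^sup>2) ^ Suc l) has_real_derivative
         (2 * real l + 3) * (1 - u\<^sup>2) ^ Suc l - (2 * real l + 2) * (1 - u\<^sup>2) ^ l) (at u within {0..1})"
        by (rule DERIV_cong) (simp add: algebra_simps power2_eq_square)
      then show "((\<lambda>u. u * (1 - u\<^sup>2) ^ Suc l) has_vector_derivative
         (2 * real l + 3) * (1 - u\<^sup>2) ^ Suc l - (2 * real l + 2) * (1 - u\<^sup>2) ^ l) (at u within {0..1})"
        by (simp only: has_real_derivative_iff_has_vector_derivative)
    qed simp
    moreover have "((\<lambda>u::real. (2 * real l + 3) * (1 - u\<^sup>2) ^ Suc l - (2 * real l + 2) * (1 - u\<^sup>2) ^ l)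
       has_integral (2 * real l + 3) * J (Suc l) - (2 * real l + 2) * J l) {0..1}"
      by (intro has_integral_diff has_integral_mult_right hi)
    ultimately have "(2 * real l + 3) * J (Suc l) - (2 * real l + 2) * J l = 1 * (1 - 1\<^sup>2) ^ Suc l - 0 * (1 - 0\<^sup>2) ^ Suc l"
      using has_integral_unique by blast
    then show ?thesis by simp
  qed
  have "J l = wu_const l"
  proof (induction l)
    case 0
    then show ?case by (simp add: J_def wu_const_def)
  next
    case (Suc l)
    have p: "pochhammer (3/2::real) l > 0" by (rule pochhammer_pos) simp
    have "J (Suc l) = (2 * real l + 2) / (2 * real l + 3) * wu_const l"
      using rec[of l] Suc by (simp add: field_simps)
    then show ?case
      using p by (simp add: wu_const_def pochhammer_Suc divide_simps) (simp add: algebra_simps)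
  qed
  moreover have "wu_primitive l 0 = wu_const l" by (simp add: wu_primitive_def)
  ultimately show ?thesis using J[of l] by simp
qed

section \<open>Power series at the right endpoint and Riemann--Liouville integrals\<close>

text \<open>The coefficients of \<open>wu_primitive l (sqrt (t / 2))\<close> in powers of
  \<open>2 - t\<close>. The power of two in the denominator comes from
  \<open>1 - t / 2 = (2 - t) / 2\<close>.\<close>

definition wu_ser :: "nat \<Rightarrow> nat \<Rightarrow> real" where
  "wu_ser l j = ((if j = 0 then wu_const l else 0)
     - (\<Sum>n\<le>l. wu_coeff l n * (pochhammer (- real n - 1/2) j / fact j))) / 2 ^ j"

lemma wu_ser_0: "wu_ser l 0 = 0"
  using wu_primitive_1[of l] by (simp add: wu_ser_def wu_primitive_def)

lemma summable_wu_ser: "summable (\<lambda>j. \<bar>wu_ser l j\<bar> * 2 ^ j)"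
proof (rule summable_comparison_test')
  have "summable (\<lambda>j. \<bar>pochhammer (- real n - 1/2) j / fact j\<bar>)" for n
    using summable_abs_pochhammer_minus[of "real n + 1/2"] by (simp add: minus_diff_commute)
  then show "summable (\<lambda>j. (if j = 0 then \<bar>wu_const l\<bar> else 0)
     + (\<Sum>n\<le>l. \<bar>wu_coeff l n\<bar> * \<bar>pochhammer (- real n - 1/2) j / fact j\<bar>))"
    by (intro summable_add summable_sum summable_mult) (auto intro: sums_summable[OF sums_If_finite[of "\<lambda>j. j = 0"]])
  fix j :: nat
  let ?S = "\<Sum>n\<le>l. wu_coeff l n * (pochhammer (- real n - 1/2) j / fact j)"
  have "\<bar>?S\<bar> \<le> (\<Sum>n\<le>l. \<bar>wu_coeff l n * (pochhammer (- real n - 1/2) j / fact j)\<bar>)"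
    by (rule sum_abs)
  also have "\<dots> = (\<Sum>n\<le>l. \<bar>wu_coeff l n\<bar> * \<bar>pochhammer (- real n - 1/2) j / fact j\<bar>)"
    by (simp only: abs_mult)
  finally have "\<bar>(if j = 0 then wu_const l else 0) - ?S\<bar> \<le> (if j = 0 then \<bar>wu_const l\<bar> else 0)
     + (\<Sum>n\<le>l. \<bar>wu_coeff l n\<bar> * \<bar>pochhammer (- real n - 1/2) j / fact j\<bar>)"
    by (smt (verit))
  then show "norm (\<bar>wu_ser l j\<bar> * 2 ^ j) \<le> (if j = 0 then \<bar>wu_const l\<bar> else 0)
     + (\<Sum>n\<le>l. \<bar>wu_coeff l n\<bar> * \<bar>pochhammer (- real n - 1/2) j / fact j\<bar>)"
    unfolding wu_ser_def abs_divide by simp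
qed

text \<open>Every hypergeometric series of the theorem is majorised by the binomial series
  of \<open>(1 - z)\<close> to the power \<open>n + 1/2\<close>, which converges absolutely up to \<open>z = 1\<close>.\<close>
lemma wu_ser_sums:
  assumes "0 \<le> x" "x \<le> 2" "\<alpha> \<ge> 0"
  shows "(\<lambda>j. wu_ser l j * fact j / pochhammer (\<alpha> + 1) j * (2 - x) ^ j) sums
     (wu_const l - (\<Sum>n\<le>l. wu_coeff l n * hyp2f1 (- real n - 1/2) 1 (\<alpha> + 1) (1 - x / 2)))"
proof -
  let ?z = "1 - x / 2"
  let ?h = "\<lambda>n j. pochhammer (- real n - 1/2) j * pochhammer 1 j / pochhammer (\<alpha> + 1) j * ?z ^ j / fact j"
  have z: "0 \<le> ?z" "?z \<le> 1" using assms by auto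
  have S: "summable (?h n)" for n
  proof (rule summable_comparison_test')
    show "summable (\<lambda>j. \<bar>pochhammer (- real n - 1/2) j / fact j\<bar>)"
      using summable_abs_pochhammer_minus[of "real n + 1/2"] by (simp add: minus_diff_commute)
    fix j :: nat
    \<comment> \<open>Factorwise comparison, with \<open>fact j = pochhammer 1 j\<close> and
      \<alpha> \<ge> 0.\<close>
    have le: "fact j \<le> pochhammer (\<alpha> + 1) j"
      using pochhammer_fact[of j, where ?'a = real] assms(3)
      by (simp add: pochhammer_prod prod_mono)
    have "?h n j = pochhammer (- real n - 1/2) j / fact j * (fact j / pochhammer (\<alpha> + 1) j * ?z ^ j)"
      by (simp flip: pochhammer_fact)
    moreover have "\<bar>fact j / pochhammer (\<alpha> + 1) j * ?z ^ j\<bar> \<le> 1"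
    proof -
      have "\<bar>fact j / pochhammer (\<alpha> + 1) j\<bar> \<le> 1"
        using le order_trans[OF fact_ge_zero le] by (simp add: abs_divide divide_le_eq)
      moreover have "\<bar>?z ^ j\<bar> \<le> 1" using z by (simp add: power_le_one)
      ultimately show ?thesis unfolding abs_mult by (intro mult_le_one) auto
    qed
    ultimately show "norm (?h n j) \<le> \<bar>pochhammer (- real n - 1/2) j / fact j\<bar>"
      by (simp only: real_norm_def abs_mult[of "pochhammer (- real n - 1/2) j / fact j"] mult_left_le[OF _ abs_ge_zero])
  qed
  have "(\<lambda>j. (if j = 0 then wu_const l else 0) - (\<Sum>n\<le>l. wu_coeff l n * ?h n j)) sums
     (wu_const l - (\<Sum>n\<le>l. wu_coeff l n * hyp2f1 (- real n - 1/2) 1 (\<alpha> + 1) ?z))"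
    unfolding hyp2f1_def
  proof (rule sums_diff)
    show "(\<lambda>j. if j = 0 then wu_const l else 0) sums wu_const l"
      by (rule sums_single)
    show "(\<lambda>j. \<Sum>n\<le>l. wu_coeff l n * ?h n j) sums (\<Sum>n\<le>l. wu_coeff l n * suminf (?h n))"
      by (rule sums_sum) (rule sums_mult[OF summable_sums[OF S]])
  qed
  moreover have "(if j = 0 then wu_const l else 0) - (\<Sum>n\<le>l. wu_coeff l n * ?h n j)
     = wu_ser l j * fact j / pochhammer (\<alpha> + 1) j * (2 - x) ^ j" for j
  proof -
    define N where "N = (if j = 0 then wu_const l else 0)
      - (\<Sum>n\<le>l. wu_coeff l n * (pochhammer (- real n - 1/2) j / fact j))"
    have "(2 - x) ^ j / 2 ^ j = ?z ^ j"
      unfolding power_divide[symmetric] by (simp add: diff_divide_distrib)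
    moreover have "wu_ser l j = N / 2 ^ j" by (simp only: wu_ser_def N_def)
    ultimately have "wu_ser l j * fact j / pochhammer (\<alpha> + 1) j * (2 - x) ^ j
      = N * (fact j / pochhammer (\<alpha> + 1) j * ?z ^ j)"
      by (metis (no_types, opaque_lifting) times_divide_eq_left times_divide_eq_right mult.assoc)
    also have "\<dots> = (if j = 0 then wu_const l else 0) - (\<Sum>n\<le>l. wu_coeff l n * ?h n j)"
    proof -
      have "(if j = 0 then wu_const l else 0) * (fact j / pochhammer (\<alpha> + 1) j * ?z ^ j) = (if j = 0 then wu_const l else 0)"
        by simp
      moreover have "(\<Sum>n\<le>l. wu_coeff l n * (pochhammer (- real n - 1/2) j / fact j)) * (fact j / pochhammer (\<alpha> + 1) j * ?z ^ j)
         = (\<Sum>n\<le>l. wu_coeff l n * ?h n j)"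
        unfolding sum_distrib_right by (intro sum.cong refl) (simp flip: pochhammer_fact)
      ultimately show ?thesis unfolding N_def by (simp only: left_diff_distrib)
    qed
    finally show ?thesis ..
  qed
  ultimately show ?thesis by (simp only:)
qed

text \<open>For \<alpha> = 0 the parameters 1 and \<alpha> + 1 cancel, and each hypergeometric
  series becomes the binomial series of \<open>x / 2\<close> to the power
  \<open>n + 1/2\<close>.\<close>

lemma wu_primitive_powser:
  assumes "0 \<le> x" "x \<le> 2"
  shows "wu_primitive l (sqrt (x / 2)) = (\<Sum>j. wu_ser l j * (2 - x) ^ j)"
proof -
  have h: "hyp2f1 (- real n - 1/2) 1 (0 + 1) (1 - x / 2) = sqrt (x / 2) ^ (2 * n + 1)" for n
  proof -
    have "hyp2f1 (- real n - 1/2) 1 (0 + 1) (1 - x / 2)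
       = (\<Sum>j. pochhammer (- (real n + 1/2)) j / fact j * (1 - x / 2) ^ j)"
      unfolding hyp2f1_def by (intro suminf_cong) (simp add: pochhammer_fact[symmetric] minus_diff_commute)
    also have "\<dots> = (1 - (1 - x / 2)) powr (real n + 1/2)"
      using assms by (intro binomial_series_closed) auto
    also have "\<dots> = sqrt (x / 2) ^ (2 * n + 1)"
    proof (cases "x = 0")
      case False
      then show ?thesis
        using assms by (simp add: powr_add powr_realpow powr_half_sqrt power_mult)
    qed simp
    finally show ?thesis .
  qed
  have "(\<Sum>j. wu_ser l j * (2 - x) ^ j) = (\<Sum>j. wu_ser l j * fact j / pochhammer (0 + 1) j * (2 - x) ^ j)"
    by (simp add: pochhammer_fact[symmetric])
  also have "\<dots> = wu_primitive l (sqrt (x / 2))"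
    unfolding sums_unique[OF wu_ser_sums[OF assms order_refl], symmetric] h wu_primitive_def ..
  finally show ?thesis ..
qed

text \<open>The Riemann--Liouville integral of order \<open>\<alpha>\<close> of \<open>t \<mapsto> wu_primitive l (sqrt (t / 2))\<close> on \<open>{t..2}\<close>,
  written as a power series at \<open>2\<close>.\<close>
definition wu_RL :: "nat \<Rightarrow> real \<Rightarrow> real \<Rightarrow> real" where
  "wu_RL l \<alpha> t = (\<Sum>j. wu_ser l j * fact j / Gamma (real j + \<alpha> + 1) * (2 - t) ^ j * rpow (2 - t) \<alpha>)"

lemma rpow_of_nat: "x \<ge> 0 \<Longrightarrow> rpow x (real m) = x ^ m"
  by (cases "m = 0") (auto simp: rpow_def powr_realpow')

lemma wu_RL_nat:
  assumes "t \<le> 2"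
  shows "wu_RL l (real m) t = (\<Sum>j. wu_ser l j * fact j / fact (j + m) * (2 - t) ^ (j + m))"
  unfolding wu_RL_def
proof (rule suminf_cong)
  fix j
  have "Gamma (real j + real m + 1) = fact (j + m)"
    using Gamma_fact[of "j + m", where ?'a = real] by (simp add: add_ac)
  then show "wu_ser l j * fact j / Gamma (real j + real m + 1) * (2 - t) ^ j * rpow (2 - t) (real m)
     = wu_ser l j * fact j / fact (j + m) * (2 - t) ^ (j + m)"
    using assms by (simp add: rpow_of_nat power_add)
qed

lemma wu_RL_0: "0 \<le> t \<Longrightarrow> t \<le> 2 \<Longrightarrow> wu_RL l 0 t = wu_primitive l (sqrt (t / 2))"
  using wu_RL_nat[of t l 0] by (simp add: wu_primitive_powser)

lemma wu_RL_2: "wu_RL l \<alpha> 2 = 0"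
proof -
  have "wu_ser l j * fact j / Gamma (real j + \<alpha> + 1) * (2 - 2) ^ j * rpow (2 - 2) \<alpha> = 0" for j
    \<comment> \<open>For \<alpha> = 0 the term \<open>j = 0\<close> is not killed by a power of
      zero, since \<open>rpow 0 0 = 1\<close>; there the vanishing of \<open>wu_ser l 0\<close> is
      what counts.\<close>
    by (cases "j = 0") (simp_all add: wu_ser_0)
  then show ?thesis unfolding wu_RL_def by (simp only: suminf_zero)
qed

lemma summable_wu_ser_fact: "summable (\<lambda>j. \<bar>wu_ser l j * fact j / fact (j + m)\<bar> * 2 ^ j)"
proof (rule summable_comparison_test'[OF summable_wu_ser[of l]])
  fix j :: nat
  have "\<bar>fact j / fact (j + m) :: real\<bar> \<le> 1"
    by (simp add: fact_mono)
  then have "\<bar>wu_ser l j * (fact j / fact (j + m))\<bar> * 2 ^ j \<le> \<bar>wu_ser l j\<bar> * 1 * 2 ^ j"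
    unfolding abs_mult by (intro mult_left_mono mult_right_mono) auto
  then show "norm (\<bar>wu_ser l j * fact j / fact (j + m)\<bar> * 2 ^ j) \<le> \<bar>wu_ser l j\<bar> * 2 ^ j"
    by (simp add: abs_mult)
qed

lemma continuous_on_wu_RL: "continuous_on {0..2} (wu_RL l (real m))"
proof -
  let ?S = "\<lambda>x. \<Sum>j. wu_ser l j * fact j / fact (j + m) * x ^ j"
  have "continuous_on {0..2} (\<lambda>t. (2 - t) ^ m * ?S (2 - t))"
    by (intro continuous_intros continuous_on_compose2[OF continuous_on_powser_Icc[OF summable_wu_ser_fact]]) auto
  moreover have "wu_RL l (real m) t = (2 - t) ^ m * ?S (2 - t)" if "t \<in> {0..2}" for t
  proof -
    have "summable (\<lambda>j. wu_ser l j * fact j / fact (j + m) * (2 - t) ^ j)"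
    proof (rule summable_comparison_test'[OF summable_wu_ser_fact[of l m]])
      fix j :: nat
      have "(2 - t) ^ j \<le> 2 ^ j" using that by (intro power_mono) auto
      then show "norm (wu_ser l j * fact j / fact (j + m) * (2 - t) ^ j) \<le> \<bar>wu_ser l j * fact j / fact (j + m)\<bar> * 2 ^ j"
        unfolding real_norm_def abs_mult using that by (intro mult_left_mono) auto
    qed
    from suminf_mult[OF this, of "(2 - t) ^ m"] show ?thesis
      using that by (simp add: wu_RL_nat power_add mult_ac)
  qed
  ultimately show ?thesis by (subst continuous_on_cong[OF refl])
qed

text \<open>The semigroup law of fractional integration: order \<nu> after order \<open>m\<close>
  gives order \<open>m + \<nu>\<close>. Termwise, the Beta integral turns
  \<open>fact (j + m)\<close> into the Gamma factor of the new order.\<close>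

lemma integral_frac_wu_RL:
  assumes "\<nu> > 0" "0 \<le> t" "t \<le> 2"
  shows "(\<integral>x. indicator {t..2} x * ((x - t) powr (\<nu> - 1) * wu_RL l (real m) x) \<partial>lborel)
    = Gamma \<nu> * wu_RL l (real m + \<nu>) t"
proof -
  let ?w = "\<lambda>j. wu_ser l j * fact j / Gamma (real j + (real m + \<nu>) + 1) * (2 - t) ^ j * rpow (2 - t) (real m + \<nu>)"
  have G: "Gamma \<nu> \<noteq> 0" using Gamma_real_pos[OF assms(1)] by simp
  have w: "wu_ser l j * fact j / fact (j + m) *
      ((2 - t) powr \<nu> * (2 - t) ^ (j + m) * fact (j + m) / pochhammer \<nu> (Suc (j + m))) = Gamma \<nu> * ?w j" for j
  proof -
    have "\<nu> \<notin> \<int>\<^sub>\<le>\<^sub>0" using assms(1) by (auto elim!: nonpos_Ints_cases)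
    from pochhammer_Gamma[OF this, of "Suc (j + m)"]
    have "pochhammer \<nu> (Suc (j + m)) = Gamma (real j + (real m + \<nu>) + 1) / Gamma \<nu>"
      by (simp add: add_ac)
    moreover have "rpow (2 - t) (real m + \<nu>) = (2 - t) powr \<nu> * (2 - t) ^ m"
    proof (cases "t = 2")
      case False
      then show ?thesis using assms by (simp add: rpow_def powr_add powr_realpow)
    qed (use assms in \<open>simp add: rpow_def\<close>)
    ultimately show ?thesis by (simp add: power_add)
  qed
  have "(\<integral>x. indicator {t..2} x * ((x - t) powr (\<nu> - 1) * wu_RL l (real m) x) \<partial>lborel)
    = (\<integral>x. indicator {t..2} x * ((x - t) powr (\<nu> - 1) *
         (\<Sum>j. wu_ser l j * fact j / fact (j + m) * (2 - x) ^ (j + m))) \<partial>lborel)" (is "?I = _")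
    by (intro Bochner_Integration.integral_cong refl) (auto simp: indicator_def wu_RL_nat)
  then have "(\<lambda>j. Gamma \<nu> * ?w j) sums ?I"
    using sums_lborel_integral_frac_powser[OF assms summable_wu_ser_fact[of l m], of m] by (simp only: w)
  then have "(\<lambda>j. inverse (Gamma \<nu>) * (Gamma \<nu> * ?w j)) sums (inverse (Gamma \<nu>) * ?I)"
    by (rule sums_mult)
  moreover have "inverse (Gamma \<nu>) * (Gamma \<nu> * y) = y" for y
    using G by simp
  ultimately have "?w sums (inverse (Gamma \<nu>) * ?I)"
    by (simp only:)
  then show ?thesis
    using G unfolding wu_RL_def by (simp add: sums_iff)
qed

text \<open>The case \<nu> = n + 1 of the semigroup law, with an ordinary power as kernel and as a
  gauge integral.\<close>

lemma integral_wu_RL: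
  assumes "0 \<le> t" "t \<le> 2"
  shows "integral {t..2} (\<lambda>x. (x - t) ^ n * wu_RL l (real m) x) = fact n * wu_RL l (real (m + Suc n)) t"
proof -
  have cont: "continuous_on {t..2} (\<lambda>x. (x - t) ^ n * wu_RL l (real m) x)"
    using assms by (intro continuous_intros continuous_on_subset[OF continuous_on_wu_RL]) auto
  note int = borel_integrable_atLeastAtMost'[OF cont]
  have "(\<integral>x. indicator {t..2} x * ((x - t) powr (real (Suc n) - 1) * wu_RL l (real m) x) \<partial>lborel)
    = (LBINT x:{t..2}. (x - t) ^ n * wu_RL l (real m) x)"
    unfolding set_lebesgue_integral_def
  proof (rule integral_cong_AE)
    show "(\<lambda>x. indicator {t..2} x *\<^sub>R ((x - t) ^ n * wu_RL l (real m) x)) \<in> borel_measurable lborel"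
      using int unfolding set_integrable_def by (rule borel_measurable_integrable)
    have *: "indicator {t..2} x * ((x - t) powr (real (Suc n) - 1) * wu_RL l (real m) x)
        = indicator {t..2} x *\<^sub>R ((x - t) ^ n * wu_RL l (real m) x)" if "x \<noteq> t" for x
      using that by (auto simp: indicator_def powr_realpow)
    \<comment> \<open>At \<open>x = t\<close> with \<open>n = 0\<close> the kernels disagree, as
      \<open>0 powr 0 = 0\<close> but \<open>0 ^ 0 = 1\<close>; hence equality almost
      everywhere.\<close>
    show "AE x in lborel. indicator {t..2} x * ((x - t) powr (real (Suc n) - 1) * wu_RL l (real m) x)
        = indicator {t..2} x *\<^sub>R ((x - t) ^ n * wu_RL l (real m) x)"
      using AE_lborel_singleton[of t] by eventually_elim (rule *)
    have "(\<lambda>x. indicator {t..2} x * wu_RL l (real m) x) \<in> borel_measurable lborel"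
      using borel_integrable_atLeastAtMost'[OF continuous_on_subset[OF continuous_on_wu_RL, of "{t..2}"], of l m] assms
      unfolding set_integrable_def real_scaleR_def by (intro borel_measurable_integrable) auto
    then have "(\<lambda>x. (x - t) powr (real (Suc n) - 1) * (indicator {t..2} x * wu_RL l (real m) x)) \<in> borel_measurable lborel"
      by measurable
    then show "(\<lambda>x. indicator {t..2} x * ((x - t) powr (real (Suc n) - 1) * wu_RL l (real m) x)) \<in> borel_measurable lborel"
      by (simp add: mult_ac)
  qed
  also have "\<dots> = integral {t..2} (\<lambda>x. (x - t) ^ n * wu_RL l (real m) x)"
    by (rule set_borel_integral_eq_integral[OF int])
  finally show ?thesis
    using integral_frac_wu_RL[of "real (Suc n)" t l m] assms Gamma_fact[of n, where ?'a = real]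
    by (simp add: add_ac)
qed

text \<open>Extension by zero beyond 2, matching the support of the self-convolution, so that
  derivatives can be taken within \<open>{0..}\<close>.\<close>

definition wu_RL_ext :: "nat \<Rightarrow> nat \<Rightarrow> real \<Rightarrow> real" where
  "wu_RL_ext l m t = (if t \<le> 2 then wu_RL l (real m) t else 0)"

lemma continuous_on_wu_RL_ext: "continuous_on {0..} (wu_RL_ext l m)"
proof -
  have "continuous_on ({0..2} \<union> {2..}) (\<lambda>t. if t \<le> 2 then wu_RL l (real m) t else 0)"
    by (rule continuous_on_cases[OF _ _ continuous_on_wu_RL]) (auto simp: wu_RL_2)
  moreover have "{0..2} \<union> {2..} = {0::real..}" by auto
  ultimately show ?thesis by (simp add: wu_RL_ext_def[abs_def])
qed

text \<open>The function of order \<open>m + 1\<close> at \<open>s\<close> is the integral from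
  \<open>s\<close> to 2 of the one of order \<open>m\<close>; continuity of the latter allows the
  fundamental theorem, also at the joint 2 and one-sidedly at 0.\<close>

lemma wu_RL_ext_deriv:
  assumes "t \<ge> 0"
  shows "(wu_RL_ext l (Suc m) has_real_derivative - wu_RL_ext l m t) (at t within {0..})"
proof -
  let ?f = "wu_RL_ext l m"
  define F where "F s = integral {0..s} ?f" for s
  have cont: "continuous_on {a..b} ?f" if "a \<ge> 0" for a b
    using that by (intro continuous_on_subset[OF continuous_on_wu_RL_ext]) auto
  have comb: "F b - F a = integral {a..b} ?f" if "0 \<le> a" "a \<le> b" for a b
    using Henstock_Kurzweil_Integration.integral_combine[OF that integrable_continuous_interval[OF cont]]
    unfolding F_def by simp
  have eq: "wu_RL_ext l (Suc m) s = F 2 - F s" if "s \<ge> 0" for s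
  proof (cases "s \<le> 2")
    case True
    have "F 2 - F s = integral {s..2} (\<lambda>x. (x - s) ^ 0 * wu_RL l (real m) x)"
      unfolding comb[OF that True] by (rule integral_cong) (simp add: wu_RL_ext_def)
    then show ?thesis
      using integral_wu_RL[OF that True, of 0] True by (simp add: wu_RL_ext_def)
  next
    case False
    have "integral {2..s} ?f = integral {2..s} (\<lambda>x. 0)"
      by (rule Henstock_Kurzweil_Integration.integral_cong) (auto simp: wu_RL_ext_def wu_RL_2 dest: antisym)
    then have "F s - F 2 = 0"
      using False by (subst comb) auto
    then have "F s = F 2" by simp
    then show ?thesis using False by (simp add: wu_RL_ext_def)
  qed
  have "(F has_real_derivative ?f t) (at t within {0..t + 1})"
    unfolding F_def by (rule integral_has_real_derivative[OF cont]) (use assms in auto)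
  \<comment> \<open>The endpoint \<open>t + 1\<close> lies beyond \<open>t\<close>, so the two
    filters agree locally.\<close>
  moreover have "at t within {0..t + 1} = at t within {0..}"
    by (rule at_within_nhd[of _ "{..<t + 1}"]) auto
  ultimately have "((\<lambda>s. F 2 - F s) has_real_derivative 0 - ?f t) (at t within {0..})"
    by (intro DERIV_diff DERIV_const) simp
  then have "((\<lambda>s. F 2 - F s) has_real_derivative - ?f t) (at t within {0..})" by simp
  then show ?thesis
    by (rule has_field_derivative_transform_within[of _ _ _ _ 1]) (use assms eq in auto)
qed

section \<open>The generalized Wu function\<close>

text \<open>The choice in \<open>rderiv\<close> is determined because every \<open>x \<ge> 0\<close>
  is a limit point of \<open>{0..}\<close>. Values at negative arguments do not enter.\<close>

lemma rderiv_eq: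
  assumes "x \<ge> 0" and f: "\<And>y. y \<ge> 0 \<Longrightarrow> f y = g y" and g: "(g has_real_derivative D) (at x within {0..})"
  shows "rderiv f x = D"
proof -
  have f': "(f has_real_derivative D) (at x within {0..})"
    by (rule has_field_derivative_transform_within[OF g, of 1]) (use assms in auto)
  have "at_right x \<le> at x within {0..}"
    using assms(1) by (intro at_le) auto
  then have "at x within {0..} \<noteq> bot"
    using trivial_limit_at_right_real[of x] by (metis le_bot)
  with f' show ?thesis
    unfolding rderiv_def by (intro some_equality) (auto intro: has_field_derivative_unique)
qed

lemma int_deriv_wu_RL_ext:
  assumes f: "\<And>x. x \<ge> 0 \<Longrightarrow> f x = K * wu_RL_ext l l x" and "n \<le> l" "x \<ge> 0"
  shows "int_deriv n f x = K * wu_RL_ext l (l - n) x"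
proof -
  have "(rderiv ^^ n) f x = (-1) ^ n * (K * wu_RL_ext l (l - n) x)"
    using assms(2,3)
  proof (induction n arbitrary: x)
    case 0
    then show ?case using f by simp
  next
    case (Suc n)
    have "rderiv ((rderiv ^^ n) f) x = (-1) ^ n * (K * - wu_RL_ext l (l - Suc n) x)"
    proof (rule rderiv_eq[OF Suc.prems(2)])
      fix y :: real assume "y \<ge> 0"
      then show "(rderiv ^^ n) f y = (-1) ^ n * (K * wu_RL_ext l (Suc (l - Suc n)) y)"
        using Suc.IH[of y] Suc.prems by (simp add: Suc_diff_Suc)
    qed (intro DERIV_cmult wu_RL_ext_deriv Suc.prems)
    then show ?case by simp
  qed
  then have "int_deriv n f x = ((-1) * (-1)) ^ n * (K * wu_RL_ext l (l - n) x)"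
    unfolding int_deriv_def power_mult_distrib by (simp only: mult.assoc)
  then show ?thesis by simp
qed

section \<open>The self-convolution as an iterated integral\<close>

text \<open>Integrate by parts with \<open>- wu_primitive l\<close> as antiderivative of
  \<open>(1 - u\<^sup>2) ^ l\<close>, then substitute \<open>x = 2 * u\<^sup>2\<close>. The result
  is an \<open>l\<close>-fold integral with kernel \<open>(x - t) ^ (l - 1)\<close>, so
  \<open>l = 0\<close> is treated separately.\<close>

lemma integral_product_wu_RL:
  assumes "0 \<le> p" "p \<le> 1"
  shows "integral {p..1} (\<lambda>u. ((u\<^sup>2 - p\<^sup>2) * (1 - u\<^sup>2)) ^ l) = fact l / 2 ^ l * wu_RL l (real l) (2 * p\<^sup>2)"
proof -
  let ?H = "wu_primitive l" and ?t = "2 * p\<^sup>2"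
  have t: "0 \<le> ?t" "?t \<le> 2" using assms by (auto simp: power_le_one)
  show ?thesis
  proof (cases l)
    case 0
    have "((\<lambda>u. - ((1 - u\<^sup>2) ^ l)) has_integral ?H 1 - ?H p) {p..1}"
      by (intro fundamental_theorem_of_calculus assms)
         (simp flip: has_real_derivative_iff_has_vector_derivative add: wu_primitive_deriv)
    then have "((\<lambda>u. - 1) has_integral - ?H p) {p..1}"
      by (simp add: 0 wu_primitive_1)
    from has_integral_neg[OF this] have "integral {p..1} (\<lambda>u. 1) = ?H p"
      by (simp only: minus_minus integral_unique)
    then show ?thesis
      using assms t by (simp add: 0 wu_RL_0)
  next
    case (Suc m)
    define \<Phi> where "\<Phi> u = 2 * real l * u * (u\<^sup>2 - p\<^sup>2) ^ m * ?H u" for u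
    have i1: "((\<lambda>u. ((u\<^sup>2 - p\<^sup>2) * (1 - u\<^sup>2)) ^ l) has_integral
        integral {p..1} (\<lambda>u. ((u\<^sup>2 - p\<^sup>2) * (1 - u\<^sup>2)) ^ l)) {p..1}"
      by (intro integrable_integral integrable_continuous_interval continuous_intros)
    have "((\<lambda>u. \<Phi> u - ((u\<^sup>2 - p\<^sup>2) * (1 - u\<^sup>2)) ^ l) has_integral
        (1\<^sup>2 - p\<^sup>2) ^ l * ?H 1 - (p\<^sup>2 - p\<^sup>2) ^ l * ?H p) {p..1}"
    proof (rule fundamental_theorem_of_calculus[OF assms(2)])
      fix u :: real
      have "((\<lambda>u. u\<^sup>2 - p\<^sup>2) has_real_derivative 2 * u) (at u within {p..1})"
        by (auto intro!: derivative_eq_intros)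
      from DERIV_mult[OF DERIV_power[OF this, of l] wu_primitive_deriv[of l u]]
      have "((\<lambda>u. (u\<^sup>2 - p\<^sup>2) ^ l * ?H u) has_real_derivative \<Phi> u - ((u\<^sup>2 - p\<^sup>2) * (1 - u\<^sup>2)) ^ l) (at u within {p..1})"
        unfolding power_mult_distrib by (rule DERIV_cong) (simp add: \<Phi>_def Suc algebra_simps)
      then show "((\<lambda>u. (u\<^sup>2 - p\<^sup>2) ^ l * ?H u) has_vector_derivative \<Phi> u - ((u\<^sup>2 - p\<^sup>2) * (1 - u\<^sup>2)) ^ l) (at u within {p..1})"
        by (simp only: has_real_derivative_iff_has_vector_derivative)
    qed
    then have "((\<lambda>u. \<Phi> u - ((u\<^sup>2 - p\<^sup>2) * (1 - u\<^sup>2)) ^ l) has_integral 0) {p..1}"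
      by (simp add: wu_primitive_1 Suc)
    from has_integral_add[OF this i1]
    have i2: "(\<Phi> has_integral integral {p..1} (\<lambda>u. ((u\<^sup>2 - p\<^sup>2) * (1 - u\<^sup>2)) ^ l)) {p..1}"
      by simp
    define f where "f x = (x - ?t) ^ m * wu_RL l (real 0) x" for x
    have "((\<lambda>u. (4 * u) *\<^sub>R f (2 * u\<^sup>2)) has_integral integral {2 * p\<^sup>2..2 * 1\<^sup>2} f) {p..1}"
    proof (rule has_integral_substitution[where c = 0 and d = 2])
      show "2 * p\<^sup>2 \<le> 2 * 1\<^sup>2" using t by simp
      show "(\<lambda>u. 2 * u\<^sup>2) ` {p..1} \<subseteq> {0..2}"
        using assms by (auto simp: power_le_one)
      show "continuous_on {0..2} f"
        unfolding f_def by (intro continuous_intros continuous_on_wu_RL)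
      show "((\<lambda>u. 2 * u\<^sup>2) has_real_derivative 4 * u) (at u within {p..1})" for u
        by (auto intro!: derivative_eq_intros)
    qed (rule assms)
    \<comment> \<open>The kernel contributes \<open>2 ^ (l - 1)\<close> and the Jacobian
      \<open>4 * u\<close> another 2 relative to the \<open>2 * u\<close> in \<Phi>; this accounts
      for \<open>2 ^ l\<close>.\<close>
    then have "((\<lambda>u. real l / 2 ^ l * ((4 * u) *\<^sub>R f (2 * u\<^sup>2))) has_integral real l / 2 ^ l * integral {2 * p\<^sup>2..2 * 1\<^sup>2} f) {p..1}"
      by (rule has_integral_mult_right)
    moreover have "real l / 2 ^ l * ((4 * u) *\<^sub>R f (2 * u\<^sup>2)) = \<Phi> u" if "u \<in> {p..1}" for u
    proof -
      have "wu_RL l (real 0) (2 * u\<^sup>2) = ?H u"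
        using that assms by (simp add: wu_RL_0 power_le_one)
      moreover have "(2 * u\<^sup>2 - ?t) ^ m = 2 ^ m * (u\<^sup>2 - p\<^sup>2) ^ m"
        by (simp add: right_diff_distrib flip: power_mult_distrib)
      ultimately show ?thesis
        by (simp add: f_def \<Phi>_def Suc)
    qed
    ultimately have "(\<Phi> has_integral real l / 2 ^ l * integral {2 * p\<^sup>2..2 * 1\<^sup>2} f) {p..1}"
      by (rule has_integral_eq[rotated])
    from has_integral_unique[OF i2 this]
    have "integral {p..1} (\<lambda>u. ((u\<^sup>2 - p\<^sup>2) * (1 - u\<^sup>2)) ^ l) = real l / 2 ^ l * integral {?t..2} f"
      by simp
    also have "integral {?t..2} f = fact m * wu_RL l (real l) ?t"
      unfolding f_def using integral_wu_RL[OF t, of m l 0] by (simp add: Suc)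
    finally show ?thesis by (simp add: Suc)
  qed
qed

lemma self_conv_eq_integral:
  assumes "0 \<le> p" "p \<le> 1"
  shows "self_conv l (2 * p) = 2 * 4 ^ l * integral {p..1} (\<lambda>u. ((u\<^sup>2 - p\<^sup>2) * (1 - u\<^sup>2)) ^ l)"
proof -
  let ?Q = "quartic 1 (- 2 * (1 + p\<^sup>2)) ((1 - p\<^sup>2)\<^sup>2)"
  let ?a = "- (1 - p)" and ?b = "1 - p"
  \<comment> \<open>The shift \<open>y = p + v\<close> centres the overlap of the two supports at
    0.\<close>
  have "self_conv l (2 * p) = (LBINT v. trunc_pow l \<bar>p + v\<bar> * trunc_pow l \<bar>p - v\<bar>)"
    unfolding self_conv_def by (subst lborel_integral_real_affine[of 1 _ p]) simp_all
  also have "\<dots> = (LBINT v:{?a<..<?b}. ?Q v ^ l)"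
    unfolding set_lebesgue_integral_def
  proof (rule Bochner_Integration.integral_cong[OF refl])
    fix v :: real
    have iff: "(p + v)\<^sup>2 < 1 \<and> (p - v)\<^sup>2 < 1 \<longleftrightarrow> v \<in> {?a<..<?b}"
      using assms by (auto simp: abs_square_less_1)
    have "(1 - (p + v)\<^sup>2) * (1 - (p - v)\<^sup>2) = ?Q v"
      unfolding quartic_def by algebra
    then have "(1 - (p + v)\<^sup>2) ^ l * (1 - (p - v)\<^sup>2) ^ l = ?Q v ^ l"
      by (simp flip: power_mult_distrib)
    then show "trunc_pow l \<bar>p + v\<bar> * trunc_pow l \<bar>p - v\<bar> = indicat_real {?a<..<?b} v *\<^sub>R ?Q v ^ l"
      unfolding trunc_pow_def power2_abs using iff by (cases "v \<in> {?a<..<?b}") auto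
  qed
  also have "\<dots> = integral {?a<..<?b} (\<lambda>v. ?Q v ^ l)"
    by (intro set_borel_integral_eq_integral set_integrable_subset[OF borel_integrable_atLeastAtMost', of ?a ?b]
          continuous_intros) auto
  also have "\<dots> = integral {?a..?b} (\<lambda>v. ?Q v ^ l)"
    by (rule integral_open_interval_real[symmetric])
  also have "\<dots> = 2 * integral {p..1} (\<lambda>u. quartic (-4) (4 * (1 + p\<^sup>2)) (- 4 * p\<^sup>2) u ^ l)"
    by (rule integral_quartic_power_transform[OF assms])
  also have "(\<lambda>u. quartic (-4) (4 * (1 + p\<^sup>2)) (- 4 * p\<^sup>2) u ^ l) = (\<lambda>u. 4 ^ l * ((u\<^sup>2 - p\<^sup>2) * (1 - u\<^sup>2)) ^ l)"
  proof
    fix u :: real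
    have "quartic (-4) (4 * (1 + p\<^sup>2)) (- 4 * p\<^sup>2) u = 4 * ((u\<^sup>2 - p\<^sup>2) * (1 - u\<^sup>2))"
      unfolding quartic_def by algebra
    then show "quartic (-4) (4 * (1 + p\<^sup>2)) (- 4 * p\<^sup>2) u ^ l = 4 ^ l * ((u\<^sup>2 - p\<^sup>2) * (1 - u\<^sup>2)) ^ l"
      by (simp only: power_mult_distrib)
  qed
  finally show ?thesis by simp
qed

lemma self_conv_ge_2:
  assumes "r \<ge> 2"
  shows "self_conv l r = 0"
proof -
  have "trunc_pow l \<bar>y\<bar> * trunc_pow l \<bar>r - y\<bar> = 0" for y
    using assms by (auto simp: trunc_pow_def abs_square_less_1)
  then show ?thesis unfolding self_conv_def by (simp only: integral_zero)
qed

text \<open>With \<open>p = sqrt (t / 2)\<close> one has \<open>sqrt (2 * t) = 2 * p\<close>; the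
  constants combine as \<open>2 * 4 ^ l * (fact l / 2 ^ l)\<close>.\<close>

lemma fform_self_conv:
  assumes "t \<ge> 0"
  shows "fform (self_conv l) t = 2 ^ Suc l * fact l * wu_RL_ext l l t"
proof (cases "t \<le> 2")
  case True
  define p where "p = sqrt (t / 2)"
  have p: "0 \<le> p" "p \<le> 1" "2 * p\<^sup>2 = t" using assms True by (auto simp: p_def)
  have "sqrt (2 * t) = sqrt (2\<^sup>2 * (t / 2))" by simp
  also have "\<dots> = 2 * p" unfolding p_def by (subst real_sqrt_mult) simp
  finally have "fform (self_conv l) t = 2 * 4 ^ l * (fact l / 2 ^ l * wu_RL l (real l) t)"
    using self_conv_eq_integral[OF p(1,2)] integral_product_wu_RL[OF p(1,2)] p(3) by (simp add: fform_def)
  also have "(4::real) ^ l = 2 ^ l * 2 ^ l" by (simp flip: power_mult_distrib)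
  finally show ?thesis using True by (simp add: wu_RL_ext_def)
next
  case False
  then have "sqrt (2 * t) \<ge> 2" by (intro real_le_rsqrt) simp
  then show ?thesis using False by (simp add: fform_def wu_RL_ext_def self_conv_ge_2)
qed

section \<open>Fractional differentiation and the closed form\<close>

text \<open>With \<open>n\<close> the ceiling of \<open>k\<close>, the \<open>n\<close> derivatives
  lower the order from \<open>l\<close> to \<open>l - n\<close>, and the fractional integral of
  order \<open>n - k\<close> raises it to \<open>l - k\<close>.\<close>

lemma wu_gen_eq_wu_RL:
  assumes "0 \<le> k" "k \<le> real l" "0 \<le> r" "r \<le> 2"
  shows "wu_gen l k r = 2 ^ Suc l * fact l * wu_RL l (real l - k) (r\<^sup>2 / 2)"
proof -
  let ?t = "r\<^sup>2 / 2" and ?K = "2 ^ Suc l * fact l :: real"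
  have t: "0 \<le> ?t" "?t \<le> 2"
    using assms power_mono[OF assms(4,3), of 2] by auto
  define n where "n = nat \<lceil>k\<rceil>"
  have n: "real n = of_int \<lceil>k\<rceil>" "real n \<ge> k" using assms(1) le_of_int_ceiling[of k] by (simp_all add: n_def del: le_of_int_ceiling)
  have "n \<le> l" using assms(2) by (simp add: n_def nat_le_iff ceiling_le_iff)
  have D: "int_deriv n (fform (self_conv l)) x = ?K * wu_RL_ext l (l - n) x" if "x \<ge> 0" for x
    by (rule int_deriv_wu_RL_ext[OF fform_self_conv \<open>n \<le> l\<close> that])
  have gen: "wu_gen l k r = frac_int (real n - k) (int_deriv n (fform (self_conv l))) ?t"
    by (simp add: wu_gen_def fform_inv_def frac_diff_def n(1)) (simp add: n_def)
  show ?thesis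
  proof (cases "real n = k")
    case True
    then show ?thesis
      using t D[OF t(1)] \<open>n \<le> l\<close> by (simp add: gen frac_int_def wu_RL_ext_def of_nat_diff)
  next
    case False
    define \<nu> where "\<nu> = real n - k"
    have \<nu>: "\<nu> > 0" using False n(2) unfolding \<nu>_def by linarith
    have "wu_gen l k r = (LBINT x:{?t..}. ((x - ?t) powr (\<nu> - 1) / Gamma \<nu>) * int_deriv n (fform (self_conv l)) x)"
      using \<nu> by (simp add: gen frac_int_def \<nu>_def)
    \<comment> \<open>Beyond 2 the extension by zero cuts off the integrand, leaving the range
      \<open>{?t..2}\<close>.\<close>
    also have "\<dots> = (\<integral>x. (?K / Gamma \<nu>) * (indicator {?t..2} x * ((x - ?t) powr (\<nu> - 1) * wu_RL l (real (l - n)) x)) \<partial>lborel)"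
      unfolding set_lebesgue_integral_def
    proof (rule Bochner_Integration.integral_cong[OF refl])
      fix x :: real
      show "indicat_real {?t..} x *\<^sub>R (((x - ?t) powr (\<nu> - 1) / Gamma \<nu>) * int_deriv n (fform (self_conv l)) x)
        = (?K / Gamma \<nu>) * (indicator {?t..2} x * ((x - ?t) powr (\<nu> - 1) * wu_RL l (real (l - n)) x))"
      proof (cases "x \<ge> ?t")
        case True
        then have "x \<ge> 0" using t by linarith
        then show ?thesis using True by (simp add: D wu_RL_ext_def indicator_def)
      qed (simp add: indicator_def)
    qed
    also have "\<dots> = (?K / Gamma \<nu>) * (Gamma \<nu> * wu_RL l (real (l - n) + \<nu>) ?t)"
      unfolding integral_mult_right_zero integral_frac_wu_RL[OF \<nu> t] ..
    also have "real (l - n) + \<nu> = real l - k"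
      using \<open>n \<le> l\<close> by (simp add: \<nu>_def of_nat_diff)
    finally show ?thesis using Gamma_real_pos[OF \<nu>] by simp
  qed
qed

text \<open>Writing \<open>Gamma (j + \<alpha> + 1)\<close> as
  \<open>Gamma (\<alpha> + 1) * pochhammer (\<alpha> + 1) j\<close> makes the prefactor independent
  of \<open>j\<close>.\<close>

lemma wu_RL_hyp2f1:
  assumes "0 \<le> t" "t \<le> 2" "\<alpha> \<ge> 0"
  shows "wu_RL l \<alpha> t = 2 powr \<alpha> / Gamma (\<alpha> + 1) * rpow (1 - t / 2) \<alpha>
    * (wu_const l - (\<Sum>n\<le>l. wu_coeff l n * hyp2f1 (- real n - 1/2) 1 (\<alpha> + 1) (1 - t / 2)))"
proof -
  have G: "Gamma (\<alpha> + 1) > 0" using assms by (intro Gamma_real_pos) simp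
  have nz: "\<alpha> + 1 \<notin> \<int>\<^sub>\<le>\<^sub>0" using assms by (auto elim!: nonpos_Ints_cases)
  have rp: "rpow (2 - t) \<alpha> = 2 powr \<alpha> * rpow (1 - t / 2) \<alpha>"
  proof -
    have "(2 * (1 - t / 2)) powr \<alpha> = 2 powr \<alpha> * (1 - t / 2) powr \<alpha>"
      using assms by (intro powr_mult)
    then show ?thesis by (simp add: rpow_def)
  qed
  let ?w = "\<lambda>j. wu_ser l j * fact j / pochhammer (\<alpha> + 1) j * (2 - t) ^ j"
  have w: "wu_ser l j * fact j / Gamma (real j + \<alpha> + 1) * (2 - t) ^ j * rpow (2 - t) \<alpha>
     = (2 powr \<alpha> / Gamma (\<alpha> + 1) * rpow (1 - t / 2) \<alpha>) * ?w j" for j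
    using G pochhammer_Gamma[OF nz, of j] by (simp add: rp add_ac)
  show ?thesis
    unfolding wu_RL_def w
    by (rule sums_unique[OF sums_mult[OF wu_ser_sums[OF assms]], symmetric])
qed

theorem theorem4p4:
  fixes l :: nat and k r :: real
  assumes "0 \<le> k" and "k \<le> real l" and "0 \<le> r" and "r \<le> 2"
  shows "wu_gen l k r =
    2 powr (2 * real l - k + 1) * Gamma (real l + 1) / Gamma (real l - k + 1)
    * rpow (1 - r\<^sup>2 / 4) (real l - k)
    * (pochhammer 1 l / pochhammer (3/2) l
       - (\<Sum>n\<le>l. pochhammer (- real l) n * pochhammer (1/2) n / pochhammer (3/2) n
            / fact n * hyp2f1 (- real n - 1/2) 1 (real l - k + 1) (1 - r\<^sup>2 / 4)))"
proof -
  have t: "0 \<le> r\<^sup>2 / 2" "r\<^sup>2 / 2 \<le> 2" "real l - k \<ge> 0"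
    using assms power_mono[OF assms(4,3), of 2] by auto
  \<comment> \<open>One factor \<open>2 ^ Suc l\<close> stems from the self-convolution, the other
    from rescaling \<open>2 - t\<close> to \<open>1 - t / 2\<close>.\<close>
  have "2 powr (2 * real l - k + 1) = 2 powr (real (Suc l) + (real l - k))" by (simp add: algebra_simps)
  also have "\<dots> = 2 ^ Suc l * 2 powr (real l - k)"
    unfolding powr_add by (simp only: powr_realpow zero_less_numeral)
  finally have "2 powr (2 * real l - k + 1) = 2 ^ Suc l * 2 powr (real l - k)" .
  moreover have "Gamma (real l + 1) = fact l"
    using Gamma_fact[of l, where ?'a = real] by (simp add: add_ac)
  ultimately show ?thesis
    unfolding wu_gen_eq_wu_RL[OF assms] wu_RL_hyp2f1[OF t] wu_const_def wu_coeff_def by simp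
qed

end
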